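(* Let $A$ be an $LC^*$-algebra. The Gelfand transform $$\mathcal{G}_A\colon A\to C_{co}(X_c^*(A)),\qquad \mathcal{G}_A(a)(\chi)=\chi(a),$$ is a homeomorphism onto its image if and only if $A$ is Hausdorff and every spectral $C^*$-seminorm on $A$ is continuous.
   Context: "Algebra" means commutative associative algebra over $\mathbb{C}$ with unit. An involutive algebra is an algebra with a conjugate-linear map $x\mapsto x^*$ satisfying $(x^* )^*=x$, $(xy)^*=y^*x^*$. A hermitian character is a unit-preserving algebra homomorphism $\chi\colon A\to\mathbb{C}$ with $\chi(x^* )=\overline{\chi(x)}$. A $C^*$-seminorm on $A$ is a seminorm $p$ with $p(xx^* )=p(x)^2$ for all $x$. An $LC^*$-algebra is an involutive algebra with a topology defined by a family of $C^*$-seminorms (not necessarily Hausdorff). $X_c^*(A)$ is the set of continuous hermitian characters of $A$ with the topology of pointwise convergence on $A$. For a topological space $T$, $C_{co}(T)$ is the algebra of all continuous functions $T\to\mathbb{C}$ with the topology of uniform convergence on compact subsets of $T$ (compact-open topology). A $C^*$-seminorm $p$ on $A$ is called spectral if every hermitian character of $A$ that is continuous with respect to (the topology defined by) $p$ alone is continuous with respect to the topology of $A$. *)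

theory Defs
  imports "HOL-Analysis.Analysis"
begin

text \<open>The algebra is carried by a type of class \<open>comm_ring\<close> (which has no unit); the unit \<open>u\<close> is
  an explicit parameter, so that, unlike with \<open>comm_ring_1\<close>, the zero algebra is not excluded.\<close>

locale involutive_algebra = vector_space scl
  for scl :: "complex \<Rightarrow> 'a::comm_ring \<Rightarrow> 'a" +
  fixes u :: 'a and star :: "'a \<Rightarrow> 'a"
  assumes scale_mult_left: "scl c x * y = scl c (x * y)"
    and unit_mult: "u * x = x"
    and star_add: "star (x + y) = star x + star y"
    and star_scale: "star (scl c x) = scl (cnj c) (star x)"
    and star_star: "star (star x) = x"
    and star_mult: "star (x * y) = star y * star x"

definition hermitian_character ::
    "(complex \<Rightarrow> 'a::comm_ring \<Rightarrow> 'a) \<Rightarrow> 'a \<Rightarrow> ('a \<Rightarrow> 'a) \<Rightarrow> ('a \<Rightarrow> complex) \<Rightarrow> bool" where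
  "hermitian_character scl u star \<phi> \<longleftrightarrow>
     Vector_Spaces.linear scl (*) \<phi> \<and>
     (\<forall>x y. \<phi> (x * y) = \<phi> x * \<phi> y) \<and> \<phi> u = 1 \<and>
     (\<forall>x. \<phi> (star x) = cnj (\<phi> x))"

definition seminorm :: "(complex \<Rightarrow> 'a::ab_group_add \<Rightarrow> 'a) \<Rightarrow> ('a \<Rightarrow> real) \<Rightarrow> bool" where
  "seminorm scl p \<longleftrightarrow>
     (\<forall>x. 0 \<le> p x) \<and> (\<forall>x y. p (x + y) \<le> p x + p y) \<and> (\<forall>c x. p (scl c x) = cmod c * p x)"

definition cstar_seminorm ::
    "(complex \<Rightarrow> 'a::comm_ring \<Rightarrow> 'a) \<Rightarrow> ('a \<Rightarrow> 'a) \<Rightarrow> ('a \<Rightarrow> real) \<Rightarrow> bool" where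
  "cstar_seminorm scl star p \<longleftrightarrow> seminorm scl p \<and> (\<forall>x. p (x * star x) = (p x)\<^sup>2)"

text \<open>\<open>UNIV\<close> is inserted because the underlying set of \<open>topology_generated_by\<close> is the union of the
  generating sets; the empty family is thus allowed and defines the indiscrete topology.\<close>

definition seminorm_topology :: "('a::ab_group_add \<Rightarrow> real) set \<Rightarrow> 'a topology" where
  "seminorm_topology P =
     topology_generated_by (insert UNIV {{y. p (y - x) < r} | p x r. p \<in> P \<and> 0 < r})"

lemma topspace_seminorm_topology [simp]: "topspace (seminorm_topology P) = UNIV"
  by (simp add: seminorm_topology_def topology_generated_by_topspace)

locale LC_star_algebra = involutive_algebra scl u star
  for scl :: "complex \<Rightarrow> 'a::comm_ring \<Rightarrow> 'a" and u star +
  fixes T :: "'a topology"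
  assumes topology_by_cstar_seminorms:
    "\<exists>P. (\<forall>p\<in>P. cstar_seminorm scl star p) \<and> T = seminorm_topology P"

definition cont_hermitian_characters ::
    "(complex \<Rightarrow> 'a::comm_ring \<Rightarrow> 'a) \<Rightarrow> 'a \<Rightarrow> ('a \<Rightarrow> 'a) \<Rightarrow> 'a topology \<Rightarrow> ('a \<Rightarrow> complex) set" where
  "cont_hermitian_characters scl u star T =
     {\<phi>. hermitian_character scl u star \<phi> \<and> continuous_map T euclidean \<phi>}"

definition char_space ::
    "(complex \<Rightarrow> 'a::comm_ring \<Rightarrow> 'a) \<Rightarrow> 'a \<Rightarrow> ('a \<Rightarrow> 'a) \<Rightarrow> 'a topology \<Rightarrow> ('a \<Rightarrow> complex) topology" where
  "char_space scl u star T =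
     subtopology (product_topology (\<lambda>_. euclidean) UNIV) (cont_hermitian_characters scl u star T)"

lemma topspace_char_space [simp]:
  "topspace (char_space scl u star T) = cont_hermitian_characters scl u star T"
  by (simp add: char_space_def)

text \<open>Continuous functions on a space \<open>X\<close> are represented by extensional functions, so that two of
  them are equal iff they agree on \<open>topspace X\<close>.\<close>

definition cont_functions :: "'b topology \<Rightarrow> ('b \<Rightarrow> complex) set" where
  "cont_functions X = {f \<in> extensional (topspace X). continuous_map X euclidean f}"

text \<open>Topology of uniform convergence on compact sets. As \<open>K\<close> is compact, the pointwise strict
  bound below says the same as \<open>sup\<close> over \<open>K\<close> of \<open>dist (g x) (f x)\<close> being less than \<open>r\<close>.\<close>

definition C_co :: "'b topology \<Rightarrow> ('b \<Rightarrow> complex) topology" where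
  "C_co X = topology_generated_by
     {{g \<in> cont_functions X. \<forall>x\<in>K. dist (g x) (f x) < r} | f K r.
        f \<in> cont_functions X \<and> compactin X K \<and> 0 < r}"

lemma topspace_C_co [simp]: "topspace (C_co X) = cont_functions X"
proof -
  have "g \<in> topspace (C_co X)" if "g \<in> cont_functions X" for g
    using that unfolding C_co_def topology_generated_by_topspace
    by (intro UnionI[of "{h \<in> cont_functions X. \<forall>x\<in>{}. dist (h x) (g x) < 1}"])
       (auto intro!: exI[of _ g] exI[of _ "{}"] exI[of _ "1::real"])
  moreover have "topspace (C_co X) \<subseteq> cont_functions X"
    unfolding C_co_def topology_generated_by_topspace by auto
  ultimately show ?thesis by blast
qed

definition gelfand ::
    "(complex \<Rightarrow> 'a::comm_ring \<Rightarrow> 'a) \<Rightarrow> 'a \<Rightarrow> ('a \<Rightarrow> 'a) \<Rightarrow> 'a topology \<Rightarrow>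
      'a \<Rightarrow> ('a \<Rightarrow> complex) \<Rightarrow> complex" where
  "gelfand scl u star T a = (\<lambda>\<phi>\<in>cont_hermitian_characters scl u star T. \<phi> a)"

lemma gelfand_in_C_co: "gelfand scl u star T a \<in> topspace (C_co (char_space scl u star T))"
proof -
  have "continuous_map (char_space scl u star T) euclidean (\<lambda>\<phi>. \<phi> a)"
    unfolding char_space_def
    by (intro continuous_map_from_subtopology continuous_map_product_projection) simp
  then have "continuous_map (char_space scl u star T) euclidean (gelfand scl u star T a)"
    by (rule continuous_map_eq) (simp add: gelfand_def)
  then show ?thesis
    by (simp add: cont_functions_def gelfand_def)
qed

definition spectral ::
    "(complex \<Rightarrow> 'a::comm_ring \<Rightarrow> 'a) \<Rightarrow> 'a \<Rightarrow> ('a \<Rightarrow> 'a) \<Rightarrow> 'a topology \<Rightarrow> ('a \<Rightarrow> real) \<Rightarrow> bool" where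
  "spectral scl u star T p \<longleftrightarrow>
     (\<forall>\<phi>. hermitian_character scl u star \<phi> \<longrightarrow>
        continuous_map (seminorm_topology {p}) euclidean \<phi> \<longrightarrow> continuous_map T euclidean \<phi>)"

end

theory Submission imports Defs begin

text \<open>Every \<open>C\<^sup>*\<close>-seminorm \<open>p\<close> is the maximum of \<open>\<bar>\<phi> x\<bar>\<close> over the hermitian characters \<open>\<phi>\<close> with
  \<open>\<bar>\<phi>\<bar> \<le> p\<close>. Completions are avoided: by Zorn's lemma there is a minimal \<open>C\<^sup>*\<close>-seminorm below \<open>p\<close> with
  the same value at \<open>x\<close>; localizing it first at \<open>x\<close> and then at any other element cannot make it
  smaller, so it is multiplicative, and Ostrowski's form of Gelfand--Mazur shows that it is the absolute value of a
  character. The characters bounded by \<open>p\<close> form a compact set, which lies in the character space of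
  \<open>A\<close> iff \<open>p\<close> is spectral. Conversely, the supremum over a compact set \<open>K\<close> of characters is a
  \<open>C\<^sup>*\<close>-seminorm whose continuous characters are the elements of \<open>K\<close>, hence spectral. Thus
  the compact-open topology induced on \<open>A\<close> is the one defined by all spectral \<open>C\<^sup>*\<close>-seminorms, and it
  always refines the topology of \<open>A\<close>.\<close>

section \<open>Algebra of C*-seminorms\<close>

text \<open>The powers of \<open>x\<close> with exponent \<open>2 ^ n\<close> are those whose
  seminorm the C*-identity determines exactly.\<close>

primrec iter_square :: "nat \<Rightarrow> 'a::times \<Rightarrow> 'a" where
  "iter_square 0 x = x"
| "iter_square (Suc n) x = iter_square n x * iter_square n x"

context involutive_algebra
begin

lemma scale_mult_right: "x * scl c y = scl c (x * y)"
  by (metis mult.commute scale_mult_left)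

lemma mult_unit: "x * u = x"
  by (metis mult.commute unit_mult)

lemma star_unit: "star u = u"
  by (metis star_mult star_star unit_mult)

lemma cstar_seminormD:
  assumes "cstar_seminorm scl star p"
  shows cstar_nonneg: "0 \<le> p x"
    and cstar_triangle: "p (x + y) \<le> p x + p y"
    and cstar_scale: "p (scl c x) = cmod c * p x"
    and cstar_identity: "p (x * star x) = (p x)\<^sup>2"
  using assms by (auto simp: cstar_seminorm_def seminorm_def)

context
  fixes p assumes p: "cstar_seminorm scl star p"
begin

lemma cstar_zero: "p 0 = 0"
  using cstar_scale[OF p, of 0 0] by simp

lemma cstar_uminus: "p (- x) = p x"
  using cstar_scale[OF p, of "-1" x] by simp

lemma cstar_minus_commute: "p (x - y) = p (y - x)"
  using cstar_uminus[of "x - y"] by simp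

lemma cstar_triangle_minus: "p (x - y) \<le> p x + p y"
  using cstar_triangle[OF p, of x "- y"] cstar_uminus[of y] by simp

lemma cstar_abs_diff: "\<bar>p x - p y\<bar> \<le> p (x - y)"
  using cstar_triangle[OF p, of "x - y" y] cstar_triangle[OF p, of "y - x" x]
    cstar_minus_commute[of x y] by simp

lemma cstar_star: "p (star x) = p x"
  using cstar_identity[OF p, of x] cstar_identity[OF p, of "star x"]
  by (metis cstar_nonneg[OF p] mult.commute power2_eq_imp_eq star_star)

text \<open>By the C*-identity and commutativity, the squares of both sides are the seminorm of the
  same product.\<close>

lemma cstar_mult_star: "p (x * star y) = p (x * y)"
proof -
  have "(p (x * star y))\<^sup>2 = (p (x * y))\<^sup>2"
    unfolding cstar_identity[OF p, symmetric] by (simp add: star_mult star_star ac_simps)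
  then show ?thesis
    by (simp add: cstar_nonneg[OF p])
qed

lemma cstar_square: "p (x * x) = (p x)\<^sup>2"
  using cstar_mult_star[of x x] cstar_identity[OF p, of x] by simp

lemma cstar_iter_square: "p (iter_square n x) = p x ^ (2 ^ n)"
  by (induction n) (simp_all add: cstar_square power_mult mult.commute flip: power_mult)

lemma cstar_mult_le_one:
  assumes "p x < 1" "p y < 1"
  shows "p (x * y) \<le> 1"
proof (rule ccontr)
  \<comment> \<open>Polarization bounds every \<open>p (a * b)\<close> with \<open>p a, p b < 1\<close>; applied to the iterated squares of
    \<open>x\<close> and \<open>y\<close> it bounds all the powers \<open>p (x * y) ^ 2 ^ n\<close>.\<close>
  assume "\<not> ?thesis"
  then have gt: "1 < p (x * y)" by simp
  have bound: "p (a * b) \<le> 2" if "p a < 1" "p b < 1" for a b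
  proof -
    have four: "scl 4 z = z + z + z + z" for z
      using scale_left_distrib[of 2 2 z] scale_left_distrib[of 1 1 z] by (simp add: algebra_simps)
    have "scl 4 (a * b) = (a + b) * (a + b) - (a - b) * (a - b)"
      by (simp add: four algebra_simps)
    then have "4 * p (a * b) = p ((a + b) * (a + b) - (a - b) * (a - b))"
      using cstar_scale[OF p, of 4 "a * b"] by simp
    also have "\<dots> \<le> (p (a + b))\<^sup>2 + (p (a - b))\<^sup>2"
      using cstar_triangle_minus by (metis cstar_square)
    also have "\<dots> \<le> 2\<^sup>2 + 2\<^sup>2"
      using cstar_triangle[OF p, of a b] cstar_triangle_minus[of a b] that
      by (intro add_mono power_mono) (auto simp: cstar_nonneg[OF p])
    finally show ?thesis by simp
  qed
  have split: "iter_square n (x * y) = iter_square n x * iter_square n y" for n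
    by (induction n) (simp_all add: ac_simps)
  have "p (x * y) ^ (2 ^ n) \<le> 2" for n
    unfolding cstar_iter_square[symmetric] split
    by (rule bound; simp add: cstar_iter_square power_less_one_iff cstar_nonneg[OF p] assms)
  moreover obtain n where "2 < p (x * y) ^ n"
    using real_arch_pow[OF gt] by blast
  moreover have "p (x * y) ^ n \<le> p (x * y) ^ (2 ^ n)"
    using gt by (intro power_increasing) (auto intro: less_imp_le)
  ultimately show False
    by (metis linorder_not_le order_trans)
qed

text \<open>Dividing the factors by bounds strictly above \<open>p x\<close> and \<open>p y\<close>
  reduces this to \<open>cstar_mult_le_one\<close>; letting the bounds tend to these values also
  covers vanishing seminorms.\<close>

lemma cstar_mult_le: "p (x * y) \<le> p x * p y"
proof -
  have *: "p (x * y) \<le> a * b" if "p x < a" "p y < b" for a b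
  proof -
    have ab: "0 < a" "0 < b"
      using that by (meson cstar_nonneg[OF p] le_less_trans)+
    have "p (scl (1/a) x * scl (1/b) y) \<le> 1"
      using that ab by (intro cstar_mult_le_one) (simp_all add: cstar_scale[OF p] norm_divide)
    then show ?thesis
      using ab by (simp add: scale_mult_left scale_mult_right cstar_scale[OF p] norm_divide norm_mult field_simps)
  qed
  have "((\<lambda>e. (p x + e) * (p y + e)) \<longlongrightarrow> (p x + 0) * (p y + 0)) (at_right 0)"
    by (intro tendsto_intros)
  moreover have "\<forall>\<^sub>F e in at_right 0. p (x * y) \<le> (p x + e) * (p y + e)"
    using eventually_at_right_less[of "0::real"] by eventually_elim (auto intro: *)
  ultimately show ?thesis
    using tendsto_lowerbound by fastforce
qed

lemma cstar_unit:
  assumes "p x \<noteq> 0"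
  shows "p u = 1"
proof -
  have "p u = (p u)\<^sup>2"
    using cstar_square[of u] by (simp add: unit_mult)
  moreover have "p u \<noteq> 0"
    using cstar_mult_le[of u x] assms cstar_nonneg[OF p, of x] by (auto simp: unit_mult)
  ultimately show ?thesis
    by (simp add: power2_eq_square)
qed

text \<open>The factor \<open>t\<close> is \<open>h\<close> to the power \<open>2 ^ n - 1\<close>;
  multiplying \<open>p t\<close> by \<open>p h\<close> avoids the subtraction in the
  exponent.\<close>

lemma iter_square_factor:
  "\<exists>t. iter_square n h = h * t \<and> p t * p h \<le> p h ^ (2 ^ n)" if "p h \<noteq> 0"
proof (induction n)
  case 0
  then show ?case
    by (intro exI[of _ u]) (simp add: mult_unit cstar_unit[OF that])
next
  case (Suc n)
  then obtain t where t: "iter_square n h = h * t" "p t * p h \<le> p h ^ (2 ^ n)" by blast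
  have "p (t * iter_square n h) * p h \<le> (p t * p h) * p (iter_square n h)"
    using mult_right_mono[OF cstar_mult_le[of t "iter_square n h"] cstar_nonneg[OF p, of h]] by (simp add: ac_simps)
  also have "\<dots> \<le> p h ^ (2 ^ n) * p h ^ (2 ^ n)"
    unfolding cstar_iter_square by (intro mult_right_mono t) (simp add: cstar_nonneg[OF p])
  finally show ?case
    by (intro exI[of _ "t * iter_square n h"]) (simp add: t(1) ac_simps flip: power_add mult_2)
qed

text \<open>The exponent \<open>2 ^ n + 1\<close> is reached from \<open>2 ^ Suc n\<close> by
  splitting off the factor \<open>t\<close> of \<open>iter_square_factor\<close>. It follows that
  localizing at \<open>h\<close> preserves the value at \<open>h\<close>.\<close>

lemma cstar_mult_iter_square_self: "p (h * iter_square n h) = p h * p h ^ (2 ^ n)"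
proof (cases "p h = 0")
  case True
  then show ?thesis
    using cstar_mult_le[of h "iter_square n h"] cstar_nonneg[OF p, of "h * iter_square n h"] by simp
next
  case False
  then have pos: "0 < p h" using cstar_nonneg[OF p, of h] by simp
  obtain t where t: "iter_square n h = h * t" "p t * p h \<le> p h ^ (2 ^ n)"
    using iter_square_factor[OF False] by blast
  have "p h * (p h ^ (2 ^ n) * p h ^ (2 ^ n)) = p h * p (iter_square n h * iter_square n h)"
    by (simp add: cstar_square cstar_iter_square power2_eq_square)
  also have "\<dots> = p h * p (h * iter_square n h * t)"
    by (simp add: t(1) ac_simps)
  also have "\<dots> \<le> p h * (p (h * iter_square n h) * p t)"
    using cstar_mult_le pos by simp
  also have "\<dots> = p (h * iter_square n h) * (p t * p h)"
    by (simp add: ac_simps)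
  also have "\<dots> \<le> p (h * iter_square n h) * p h ^ (2 ^ n)"
    by (intro mult_left_mono t cstar_nonneg[OF p])
  finally have "p h * p h ^ (2 ^ n) \<le> p (h * iter_square n h)"
    using pos by (simp flip: mult.assoc)
  moreover have "p (h * iter_square n h) \<le> p h * p h ^ (2 ^ n)"
    using cstar_mult_le[of h "iter_square n h"] by (simp add: cstar_iter_square)
  ultimately show ?thesis by simp
qed

end

section \<open>Localization and minimality of C*-seminorms\<close>

lemma cstar_seminormI:
  assumes "\<And>x. 0 \<le> q x" "\<And>x y. q (x + y) \<le> q x + q y"
    and le: "\<And>c x. c \<noteq> 0 \<Longrightarrow> q (scl c x) \<le> cmod c * q x" and zero: "q 0 = 0"
    and "\<And>x. q (x * star x) = (q x)\<^sup>2"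
  shows "cstar_seminorm scl star q"
proof -
  have "q (scl c x) = cmod c * q x" for c x
  proof (cases "c = 0")
    case False
    then show ?thesis
      using le[of c x] le[of "inverse c" "scl c x"]
      by (simp add: norm_inverse) (simp add: field_simps)
  qed (simp add: zero)
  then show ?thesis
    using assms by (simp add: cstar_seminorm_def seminorm_def)
qed

text \<open>Localization at \<open>h\<close>: on the functions on a compact space it is the supremum over the set where
  \<open>\<bar>h\<bar>\<close> is maximal.\<close>

lemma localized_cstar_seminorm:
  assumes q: "cstar_seminorm scl star q" and h: "q h \<noteq> 0"
  obtains q' where "cstar_seminorm scl star q'" "q' \<le> q"
    "\<And>a. (\<lambda>n. q (a * iter_square n h) / q h ^ (2 ^ n)) \<longlonglongrightarrow> q' a"
    "\<And>a. q' a \<le> q (a * h) / q h"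
proof -
  define r where "r a n = q (a * iter_square n h) / q h ^ (2 ^ n)" for a n
  have pos: "0 < q h" using h cstar_nonneg[OF q, of h] by simp
  have r_nonneg: "0 \<le> r a n" for a n
    by (simp add: r_def cstar_nonneg[OF q])
  have dec: "decseq (r a)" for a
  proof (rule decseq_SucI)
    fix n
    have "q (a * iter_square n h * iter_square n h) \<le> q (a * iter_square n h) * q h ^ (2 ^ n)"
      using cstar_mult_le[OF q] by (metis cstar_iter_square[OF q])
    then show "r a (Suc n) \<le> r a n"
      using pos by (simp add: r_def divide_simps mult_2 power_add mult.assoc)
  qed
  have "\<exists>l. r a \<longlonglongrightarrow> l \<and> (\<forall>n. l \<le> r a n)" for a
    using decseq_convergent[OF dec, of 0] r_nonneg by metis
  then obtain q' where q': "\<And>a. r a \<longlonglongrightarrow> q' a" "\<And>a n. q' a \<le> r a n"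
    by metis
  have "cstar_seminorm scl star q'"
  proof (rule cstar_seminormI)
    show "0 \<le> q' a" for a
      using LIMSEQ_le_const[OF q'(1)] r_nonneg by blast
    show "q' (a + b) \<le> q' a + q' b" for a b
    proof (rule LIMSEQ_le[OF q'(1) tendsto_add[OF q'(1) q'(1)]])
      show "\<exists>N. \<forall>n\<ge>N. r (a + b) n \<le> r a n + r b n"
        using cstar_triangle[OF q] pos
        by (auto simp: r_def distrib_right add_divide_distrib[symmetric] intro!: divide_right_mono)
    qed
    show "q' (scl c a) \<le> cmod c * q' a" for c a
    proof (rule LIMSEQ_le[OF q'(1) tendsto_mult_left[OF q'(1)]])
      show "\<exists>N. \<forall>n\<ge>N. r (scl c a) n \<le> cmod c * r a n"
        by (simp add: r_def scale_mult_left cstar_scale[OF q])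
    qed
    show "q' 0 = 0"
      using LIMSEQ_unique[OF q'(1)[of 0]] by (simp add: r_def[abs_def] cstar_zero[OF q])
    \<comment> \<open>The index is shifted because the square of term \<open>n\<close> for
      \<open>a\<close> is term \<open>Suc n\<close> for \<open>a * star a\<close>.\<close>
    show "q' (a * star a) = (q' a)\<^sup>2" for a
    proof (rule LIMSEQ_unique[OF LIMSEQ_Suc[OF q'(1)]])
      have "r (a * star a) (Suc n) = (r a n)\<^sup>2" for n
      proof -
        have "q (a * star a * iter_square n h * iter_square n h)
            = q (a * star a * iter_square n h * star (iter_square n h))"
          by (simp add: cstar_mult_star[OF q])
        also have "\<dots> = (q (a * iter_square n h))\<^sup>2"
          by (simp add: cstar_identity[OF q, symmetric] star_mult ac_simps)
        finally show ?thesis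
          by (simp add: r_def ac_simps power_divide flip: power_mult)
      qed
      then show "(\<lambda>n. r (a * star a) (Suc n)) \<longlonglongrightarrow> (q' a)\<^sup>2"
        using tendsto_power[OF q'(1)[of a], of 2] by simp
    qed
  qed
  moreover have "q' a \<le> q (a * h) / q h" for a
    using q'(2)[of a 0] by (simp add: r_def)
  moreover have "q' a \<le> q a" for a
    using q'(2)[of a 0] cstar_mult_le[OF q, of a h] pos
    by (simp add: r_def) (meson order_trans pos_divide_le_eq)
  ultimately show ?thesis
    using that q'(1) by (auto simp: r_def[abs_def] le_fun_def)
qed

text \<open>The chain condition serves the triangle inequality, where two members are replaced by
  the smaller of them.\<close>

lemma cstar_seminorm_chain_Inf:
  assumes C: "C \<noteq> {}" "\<And>q. q \<in> C \<Longrightarrow> cstar_seminorm scl star q"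
    and chain: "\<And>q q'. q \<in> C \<Longrightarrow> q' \<in> C \<Longrightarrow> q \<le> q' \<or> q' \<le> q"
  shows "cstar_seminorm scl star (\<lambda>x. INF q\<in>C. q x)" (is "cstar_seminorm _ _ ?i")
    and "q \<in> C \<Longrightarrow> (\<lambda>x. INF q\<in>C. q x) \<le> q"
proof -
  have low: "?i x \<le> q x" if "q \<in> C" for q x
    by (rule cINF_lower[OF bdd_belowI2[of _ 0]]) (use C that cstar_nonneg in auto)
  then show "q \<in> C \<Longrightarrow> ?i \<le> q" by (simp add: le_fun_def)
  have great: "m \<le> ?i x" if "\<And>q. q \<in> C \<Longrightarrow> m \<le> q x" for m x
    using that by (intro cINF_greatest C(1))
  have nonneg: "0 \<le> ?i x" for x
    by (intro great cstar_nonneg C)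
  show "cstar_seminorm scl star ?i"
  proof (rule cstar_seminormI)
    show "0 \<le> ?i x" for x by (rule nonneg)
    show "?i (x + y) \<le> ?i x + ?i y" for x y
    proof -
      have *: "?i (x + y) \<le> q x + q' y" if "q \<in> C" "q' \<in> C" for q q'
      proof -
        obtain q0 where q0: "q0 \<in> C" "q0 \<le> q" "q0 \<le> q'"
          using chain[OF \<open>q \<in> C\<close> \<open>q' \<in> C\<close>] \<open>q \<in> C\<close> \<open>q' \<in> C\<close> by blast
        have "?i (x + y) \<le> q0 x + q0 y"
          using low[OF q0(1)] cstar_triangle[OF C(2)[OF q0(1)]] order_trans by blast
        also have "\<dots> \<le> q x + q' y"
          using q0 by (intro add_mono) (auto simp: le_fun_def)
        finally show ?thesis .
      qed
      have "?i (x + y) - q' y \<le> ?i x" if "q' \<in> C" for q'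
        by (rule great) (use * that in force)
      then have "?i (x + y) - ?i x \<le> ?i y"
        by (intro great) force
      then show ?thesis by simp
    qed
    show "?i (scl c x) \<le> cmod c * ?i x" if "c \<noteq> 0" for c x
    proof -
      have "?i (scl c x) / cmod c \<le> q x" if "q \<in> C" for q
        using low[OF that, of "scl c x"] \<open>c \<noteq> 0\<close> 
        by (simp add: cstar_scale[OF C(2)[OF that]] field_simps)
      then have "?i (scl c x) / cmod c \<le> ?i x" by (rule great)
      then show ?thesis using that by (simp add: field_simps)
    qed
    obtain q where "q \<in> C" using C(1) by blast
    then show "?i 0 = 0"
      using low[of q 0] nonneg[of 0] cstar_zero[OF C(2)[of q]] by simp
    show "?i (x * star x) = (?i x)\<^sup>2" for x
    proof (rule antisym)
      have "sqrt (?i (x * star x)) \<le> q x" if "q \<in> C" for q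
        using low[OF that, of "x * star x"] cstar_nonneg[OF C(2)[OF that]]
        by (simp add: cstar_identity[OF C(2)[OF that]] real_le_lsqrt)
      then have "sqrt (?i (x * star x)) \<le> ?i x" by (rule great)
      then show "?i (x * star x) \<le> (?i x)\<^sup>2" by (rule sqrt_le_D)
      show "(?i x)\<^sup>2 \<le> ?i (x * star x)"
      proof (rule great)
        fix q assume "q \<in> C"
        then show "(?i x)\<^sup>2 \<le> q (x * star x)"
          using low nonneg by (simp add: cstar_identity[OF C(2)] power_mono)
      qed
    qed
  qed
qed

text \<open>Zorn's lemma for the reversed order: among the C*-seminorms below \<open>p\<close> that
  agree with it at \<open>x\<close>, a nonempty chain is bounded by its infimum.\<close>

lemma minimal_cstar_seminorm:
  assumes p: "cstar_seminorm scl star p"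
  obtains q where "cstar_seminorm scl star q" "q \<le> p" "q x = p x"
    "\<And>q'. cstar_seminorm scl star q' \<Longrightarrow> q' \<le> q \<Longrightarrow> q' x = q x \<Longrightarrow> q' = q"
proof -
  define S where "S = {q. cstar_seminorm scl star q \<and> q \<le> p \<and> q x = p x}"
  have "\<exists>q\<in>S. \<forall>q'\<in>S. q \<ge> q' \<longrightarrow> q' = q"
  proof (rule predicate_Zorn)
    show "partial_order_on S (relation_of (\<ge>) S)"
      by (rule partial_order_on_relation_ofI) auto
    fix C assume "C \<in> Chains (relation_of (\<ge>) S)"
    then have CS: "C \<subseteq> S" and chain: "\<And>q q'. q \<in> C \<Longrightarrow> q' \<in> C \<Longrightarrow> q \<le> q' \<or> q' \<le> q"
      by (auto simp: Chains_def relation_of_def)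
    show "\<exists>q\<in>S. \<forall>q'\<in>C. q' \<ge> q"
    proof (cases "C = {}")
      case True
      then show ?thesis using p by (auto simp: S_def)
    next
      case False
      note I = cstar_seminorm_chain_Inf[OF False _ chain]
      have C: "\<And>q. q \<in> C \<Longrightarrow> cstar_seminorm scl star q" using CS by (auto simp: S_def)
      let ?i = "\<lambda>x. INF q\<in>C. q x"
      have low: "\<And>q. q \<in> C \<Longrightarrow> ?i \<le> q" by (rule I(2)) (use C in auto)
      have "?i x = (INF q\<in>C. p x)"
        using CS by (intro INF_cong) (auto simp: S_def)
      then have "?i x = p x" using False by simp
      moreover obtain q where "q \<in> C" using False by blast
      moreover from this have "?i \<le> p"
        using low[of q] CS order_trans by (force simp: S_def)
      ultimately have "?i \<in> S" using I(1) C by (auto simp: S_def)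
      then show ?thesis using low by blast
    qed
  qed
  then obtain q where q: "q \<in> S" "\<And>q'. q' \<in> S \<Longrightarrow> q' \<le> q \<Longrightarrow> q' = q" by blast
  have "q' = q" if "cstar_seminorm scl star q'" "q' \<le> q" "q' x = q x" for q'
  proof (rule q(2))
    show "q' \<in> S" using that q(1) order_trans by (force simp: S_def)
  qed (use that in auto)
  then show ?thesis using that q(1) by (auto simp: S_def)
qed

lemma multiplicative_cstar_seminorm:
  assumes p: "cstar_seminorm scl star p"
  obtains q where "cstar_seminorm scl star q" "q \<le> p" "q x = p x" "\<And>a b. q (a * b) = q a * q b"
proof -
  obtain q where q: "cstar_seminorm scl star q" "q \<le> p" "q x = p x"
    and min: "\<And>q'. cstar_seminorm scl star q' \<Longrightarrow> q' \<le> q \<Longrightarrow> q' x = q x \<Longrightarrow> q' = q"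
    using minimal_cstar_seminorm[OF p] by blast
  note qm = cstar_mult_le[OF q(1)]
  \<comment> \<open>Under this premise localizing at \<open>h\<close> keeps the value at
    \<open>x\<close>, so minimality gives \<open>q' = q\<close>; the bound on \<open>q'\<close> then
    reverses submultiplicativity.\<close>
  have mult: "q (a * h) = q a * q h"
    if "\<And>n. q (x * iter_square n h) = q x * q h ^ (2 ^ n)" for a h
  proof (cases "q h = 0")
    case True
    then show ?thesis using qm[of a h] cstar_nonneg[OF q(1), of "a * h"] by simp
  next
    case False
    obtain q' where q': "cstar_seminorm scl star q'" "q' \<le> q"
      "(\<lambda>n. q (x * iter_square n h) / q h ^ (2 ^ n)) \<longlonglongrightarrow> q' x"
      "\<And>a. q' a \<le> q (a * h) / q h"
      using localized_cstar_seminorm[OF q(1) False] by metis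
    have "q' x = q x"
      using LIMSEQ_unique[OF q'(3)] False by (simp add: that)
    then have "q' = q" using min q' by blast
    then have "q a * q h \<le> q (a * h)"
      using q'(4)[of a] False cstar_nonneg[OF q(1), of h] by (simp add: pos_le_divide_eq)
    then show ?thesis using qm[of a h] by simp
  qed
  \<comment> \<open>The case \<open>h = x\<close> comes first: multiplicativity against
    \<open>x\<close> is what verifies the premise of \<open>mult\<close> for every other
    element.\<close>
  have "q (a * x) = q a * q x" for a
    by (rule mult) (rule cstar_mult_iter_square_self[OF q(1)])
  then have "q (a * b) = q a * q b" for a b
    by (intro mult) (simp add: cstar_iter_square[OF q(1)] mult.commute[of x])
  then show ?thesis using that q by blast
qed


section \<open>Characters from multiplicative seminorms\<close>

lemma hermitian_characterD:
  assumes "hermitian_character scl u star \<phi>"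
  shows character_add: "\<phi> (x + y) = \<phi> x + \<phi> y"
    and character_diff: "\<phi> (x - y) = \<phi> x - \<phi> y"
    and character_zero: "\<phi> 0 = 0"
    and character_scale: "\<phi> (scl c x) = c * \<phi> x"
    and character_mult: "\<phi> (x * y) = \<phi> x * \<phi> y"
    and character_unit: "\<phi> u = 1"
    and character_star: "\<phi> (star x) = cnj (\<phi> x)"
proof -
  interpret Vector_Spaces.linear scl "(*)" \<phi>
    using assms by (simp add: hermitian_character_def)
  show "\<phi> (x + y) = \<phi> x + \<phi> y" "\<phi> (x - y) = \<phi> x - \<phi> y" "\<phi> 0 = 0" "\<phi> (scl c x) = c * \<phi> x"
    by (rule add diff zero scale)+
qed (use assms in \<open>auto simp: hermitian_character_def\<close>)

lemma character_sum:
  assumes "hermitian_character scl u star \<phi>"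
  shows "\<phi> (\<Sum>i\<in>I. f i) = (\<Sum>i\<in>I. \<phi> (f i))"
  by (induction I rule: infinite_finite_induct) (simp_all add: hermitian_characterD[OF assms])

lemma character_iter_square:
  assumes "hermitian_character scl u star \<phi>"
  shows "\<phi> (iter_square n x) = \<phi> x ^ (2 ^ n)"
  by (induction n) (simp_all add: character_mult[OF assms] mult_2 power_add)

context
  fixes q assumes q: "cstar_seminorm scl star q"
    and mult: "\<And>a b. q (a * b) = q a * q b"
    and unit: "q u = 1"
begin

lemma norm_scale_unit: "q (scl c u) = cmod c"
  by (simp add: cstar_scale[OF q] unit)

text \<open>Each step factors a difference of squares into shifts by plus and minus
  \<open>csqrt c\<close>, which is why the induction needs every \<open>c\<close>.\<close>

lemma iter_square_shift_ge:
  assumes "0 \<le> m" and ge: "\<And>c. m \<le> q (y - scl c u)"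
  shows "m ^ (2 ^ n) \<le> q (iter_square n y - scl c u)"
proof (induction n arbitrary: c)
  case (Suc n)
  have "iter_square (Suc n) y - scl c u
    = (iter_square n y - scl (csqrt c) u) * (iter_square n y - scl (- csqrt c) u)"
    by (simp add: algebra_simps scale_mult_left scale_mult_right unit_mult mult_unit scale_minus_left
      flip: power2_eq_square)
  then have "q (iter_square (Suc n) y - scl c u)
    = q (iter_square n y - scl (csqrt c) u) * q (iter_square n y - scl (- csqrt c) u)"
    by (simp only: mult)
  also have "\<dots> \<ge> m ^ (2 ^ n) * m ^ (2 ^ n)"
    by (intro mult_mono Suc) (simp_all add: assms(1) cstar_nonneg[OF q])
  finally show ?case by (simp add: mult_2 power_add)
qed (use ge in simp)

text \<open>Ostrowski's argument for Gelfand--Mazur: the distance from \<open>x\<close> to the line of scalars cannot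
  have a positive minimum, since it would then be constant on a disc around every minimizer.\<close>

lemma min_spreads:
  assumes "0 < m" and ge: "\<And>c. m \<le> q (y - scl c u)" and y: "q y = m" and \<mu>: "cmod \<mu> < m"
  shows "q (y - scl \<mu> u) = m"
proof -
  \<comment> \<open>The cofactor of \<open>y - scl \<mu> u\<close> is a product of shifts of
    \<open>iter_square k y\<close> for \<open>k < n\<close>, of seminorm at least \<open>m\<close>
    to the power \<open>2 ^ n - 1\<close>. The extra \<open>m\<close> on the right avoids the
    subtraction.\<close>
  have *: "q (y - scl \<mu> u) * m ^ (2 ^ n) \<le> m * q (iter_square n y - scl (\<mu> ^ (2 ^ n)) u)" for n
  proof (induction n)
    case (Suc n)
    have "iter_square (Suc n) y - scl (\<mu> ^ (2 ^ Suc n)) u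
      = (iter_square n y - scl (\<mu> ^ (2 ^ n)) u) * (iter_square n y - scl (- (\<mu> ^ (2 ^ n))) u)"
      by (simp add: algebra_simps scale_mult_left scale_mult_right unit_mult mult_unit scale_minus_left
         mult_2 power_add)
    then have "m * q (iter_square (Suc n) y - scl (\<mu> ^ (2 ^ Suc n)) u)
      = m * q (iter_square n y - scl (\<mu> ^ (2 ^ n)) u) * q (iter_square n y - scl (- (\<mu> ^ (2 ^ n))) u)"
      by (simp only: mult mult.assoc)
    also have "\<dots> \<ge> (q (y - scl \<mu> u) * m ^ (2 ^ n)) * m ^ (2 ^ n)"
      using assms(1) by (intro mult_mono Suc iter_square_shift_ge ge) (simp_all add: cstar_nonneg[OF q])
    finally show ?case by (simp add: mult_2 power_add mult.assoc)
  qed (simp add: mult.commute)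
  have "q (y - scl \<mu> u) \<le> m * (1 + (cmod \<mu> / m) ^ (2 ^ n))" for n
  proof -
    have "q (iter_square n y - scl (\<mu> ^ (2 ^ n)) u) \<le> m ^ (2 ^ n) + cmod \<mu> ^ (2 ^ n)"
      using cstar_triangle_minus[OF q, of "iter_square n y" "scl (\<mu> ^ (2 ^ n)) u"]
      by (simp add: cstar_iter_square[OF q] norm_scale_unit norm_power y)
    then have "q (y - scl \<mu> u) * m ^ (2 ^ n) \<le> m * (m ^ (2 ^ n) + cmod \<mu> ^ (2 ^ n))"
      using *[of n] assms(1) by (meson less_imp_le mult_left_mono order_trans)
    then show ?thesis
      using assms(1) by (simp add: power_divide field_simps)
  qed
  moreover have "(\<lambda>n. m * (1 + (cmod \<mu> / m) ^ (2 ^ n))) \<longlonglongrightarrow> m * (1 + 0)"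
  proof (intro tendsto_intros)
    have "(\<lambda>n. (cmod \<mu> / m) ^ n) \<longlonglongrightarrow> 0"
      using assms(1) \<mu> by (intro LIMSEQ_power_zero) simp
    moreover have "strict_mono (\<lambda>n. 2 ^ n :: nat)"
      by (simp add: strict_mono_def)
    ultimately show "(\<lambda>n. (cmod \<mu> / m) ^ (2 ^ n)) \<longlonglongrightarrow> 0"
      using LIMSEQ_subseq_LIMSEQ[of _ 0 "\<lambda>n. 2 ^ n"] by (force simp: o_def)
  qed
  ultimately have "q (y - scl \<mu> u) \<le> m"
    using LIMSEQ_le_const by fastforce
  then show ?thesis using ge[of \<mu>] by simp
qed

text \<open>The distance \<open>f c\<close> from \<open>x\<close> to \<open>scl c u\<close> is
  continuous and grows with \<open>cmod c\<close>, so it has a minimum \<open>m\<close>. If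
  \<open>m\<close> were positive, \<open>min_spreads\<close> would carry the value \<open>m\<close>
  in steps of \<open>m / 2\<close> to arbitrarily distant scalars, against this growth.\<close>

lemma scalar_mod_kernel: "\<exists>c. q (x - scl c u) = 0"
proof -
  define f where "f c = q (x - scl c u)" for c
  have f_lip: "\<bar>f c - f d\<bar> \<le> cmod (c - d)" for c d
  proof -
    have "(x - scl c u) - (x - scl d u) = scl (d - c) u"
      by (simp add: scale_left_diff_distrib)
    then show ?thesis
      using cstar_abs_diff[OF q, of "x - scl c u" "x - scl d u"]
      by (simp add: f_def norm_scale_unit norm_minus_commute)
  qed
  have f_ge: "cmod c - q x \<le> f c" for c
    using cstar_abs_diff[OF q, of "scl c u" x] cstar_minus_commute[OF q, of "scl c u" x]
    by (simp add: f_def norm_scale_unit)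
  \<comment> \<open>Outside this disc the bound \<open>f_ge\<close> exceeds
    \<open>q x = f 0\<close>, so a minimum on the disc is global.\<close>
  have "continuous_on (cball 0 (2 * q x)) f"
    unfolding continuous_on_iff dist_norm real_norm_def using f_lip by (meson le_less_trans)
  then obtain c0 where c0: "\<And>c. cmod c \<le> 2 * q x \<Longrightarrow> f c0 \<le> f c"
    using continuous_attains_inf[of "cball 0 (2 * q x)" f] cstar_nonneg[OF q, of x]
    by (force simp: Ball_def)
  have min: "f c0 \<le> f c" for c
  proof (cases "cmod c \<le> 2 * q x")
    case False
    then show ?thesis
      using f_ge[of c] c0[of 0] cstar_nonneg[OF q, of x] by (simp add: f_def)
  qed (rule c0)
  define m where "m = f c0"
  have "m = 0"
  proof (rule ccontr)
    assume "m \<noteq> 0"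
    then have "0 < m" using cstar_nonneg[OF q] by (simp add: m_def f_def less_le)
    have f_const: "f (c0 + of_nat k * of_real (m / 2)) = m" for k
    proof (induction k)
      case (Suc k)
      let ?y = "x - scl (c0 + of_nat k * of_real (m / 2)) u"
      have shift: "?y - scl c u = x - scl (c0 + of_nat k * of_real (m / 2) + c) u" for c
        by (simp add: scale_left_distrib algebra_simps)
      have "q (?y - scl (of_real (m / 2)) u) = m"
      proof (rule min_spreads)
        show "m \<le> q (?y - scl c u)" for c
          unfolding shift using min by (simp add: m_def f_def)
      qed (use \<open>0 < m\<close> Suc in \<open>simp_all add: f_def\<close>)
      moreover have "c0 + of_nat k * of_real (m / 2) + of_real (m / 2)
          = c0 + of_nat (Suc k) * of_real (m / 2)"
        by (simp add: algebra_simps)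
      ultimately show ?case
        unfolding shift f_def by (simp only:)
    qed (simp add: m_def)
    obtain k where k: "cmod c0 + q x + m < of_nat k * (m / 2)"
      using reals_Archimedean3 \<open>0 < m\<close> by (metis half_gt_zero)
    have "of_nat k * (m / 2) - cmod c0 \<le> cmod (c0 + of_nat k * of_real (m / 2))"
      using norm_triangle_ineq4[of "c0 + of_nat k * of_real (m / 2)" c0] \<open>0 < m\<close>
      by (simp add: norm_mult norm_divide)
    then show False
      using f_ge[of "c0 + of_nat k * of_real (m / 2)"] k unfolding f_const by simp
  qed
  then show ?thesis by (auto simp: m_def f_def)
qed

text \<open>The kernel of \<open>q\<close> is an ideal modulo which every element is a scalar,
  unique because \<open>q u = 1\<close>. The identities for \<open>\<phi>\<close> are therefore
  checked modulo the kernel.\<close>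

lemma character_of_multiplicative_seminorm:
  obtains \<phi> where "hermitian_character scl u star \<phi>" "\<And>x. cmod (\<phi> x) = q x"
proof -
  obtain \<phi> where \<phi>: "\<And>x. q (x - scl (\<phi> x) u) = 0"
    using scalar_mod_kernel by metis
  have eqI: "\<phi> x = c" if "q (x - scl c u) = 0" for x c
  proof -
    have "q ((x - scl (\<phi> x) u) - (x - scl c u)) \<le> 0"
      using cstar_triangle_minus[OF q] by (metis add_0 \<phi> that)
    moreover have "(x - scl (\<phi> x) u) - (x - scl c u) = scl (c - \<phi> x) u"
      by (simp add: scale_left_diff_distrib)
    ultimately show ?thesis by (simp add: norm_scale_unit)
  qed
  have eqI_sum: "\<phi> x = c" if "x - scl c u = y + z" "q y = 0" "q z = 0" for x c y z
  proof (rule eqI)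
    show "q (x - scl c u) = 0"
      using cstar_triangle[OF q, of y z] cstar_nonneg[OF q, of "y + z"] that by simp
  qed
  have add: "\<phi> (x + y) = \<phi> x + \<phi> y" for x y
    by (rule eqI_sum[of _ _ "x - scl (\<phi> x) u" "y - scl (\<phi> y) u"])
      (simp_all add: \<phi> scale_left_distrib)
  have scale: "\<phi> (scl c x) = c * \<phi> x" for c x
    by (rule eqI_sum[of _ _ "scl c (x - scl (\<phi> x) u)" 0])
      (simp add: scale_right_diff_distrib, simp_all add: \<phi> cstar_scale[OF q] cstar_zero[OF q])
  have times: "\<phi> (x * y) = \<phi> x * \<phi> y" for x y
    by (rule eqI_sum[of _ _ "(x - scl (\<phi> x) u) * y" "scl (\<phi> x) (y - scl (\<phi> y) u)"])
      (simp add: left_diff_distrib scale_right_diff_distrib scale_mult_left unit_mult,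
        simp_all add: \<phi> cstar_scale[OF q] mult)
  have star: "\<phi> (star x) = cnj (\<phi> x)" for x
  proof (rule eqI)
    have "star (x - y) = star x - star y" for x y
      using star_add[of "x - y" y] by simp
    then have "star x - scl (cnj (\<phi> x)) u = star (x - scl (\<phi> x) u)"
      by (simp add: star_scale star_unit)
    then show "q (star x - scl (cnj (\<phi> x)) u) = 0"
      by (simp add: cstar_star[OF q] \<phi>)
  qed
  have "\<phi> u = 1"
    by (rule eqI) (simp add: cstar_zero[OF q])
  moreover have "Vector_Spaces.linear scl (*) \<phi>"
    unfolding Vector_Spaces.linear_iff
    using add scale vector_space_axioms vector_space_over_itself.vector_space_axioms by blast
  moreover have "cmod (\<phi> x) = q x" for x
    using cstar_abs_diff[OF q, of x "scl (\<phi> x) u"] by (simp add: \<phi> norm_scale_unit)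
  ultimately show ?thesis
    using that add scale times star by (auto simp: hermitian_character_def)
qed

end

theorem cstar_seminorm_attained:
  assumes p: "cstar_seminorm scl star p" and "p x \<noteq> 0"
  obtains \<phi> where "hermitian_character scl u star \<phi>" "\<And>a. cmod (\<phi> a) \<le> p a" "cmod (\<phi> x) = p x"
proof -
  obtain q where q: "cstar_seminorm scl star q" "q \<le> p" "q x = p x" "\<And>a b. q (a * b) = q a * q b"
    using multiplicative_cstar_seminorm[OF p] by blast
  moreover have "q u = 1"
    using cstar_unit[OF q(1), of x] q(3) assms(2) by simp
  ultimately show ?thesis
    using character_of_multiplicative_seminorm that by (metis le_fun_def)
qed

end

section \<open>Topologies\<close>

lemma seminorm_topology_coarsest:
  assumes "\<And>p x r. p \<in> P \<Longrightarrow> 0 < r \<Longrightarrow> openin X {y. p (y - x) < r}"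
    and "topspace X = UNIV" and "openin (seminorm_topology P) U"
  shows "openin X U"
proof (rule generate_topology_on_coarsest)
  show "istopology (openin X)" by simp
  show "generate_topology_on (insert UNIV {{y. p (y - x) < r} | p x r. p \<in> P \<and> 0 < r}) U"
    using assms(3) unfolding seminorm_topology_def by (rule openin_topology_generated_by)
qed (use assms(1,2) openin_topspace[of X] in auto)

lemma openin_seminorm_ball: "p \<in> P \<Longrightarrow> 0 < r \<Longrightarrow> openin (seminorm_topology P) {y. p (y - x) < r}"
  unfolding seminorm_topology_def by (rule topology_generated_by_Basis) auto

lemma continuous_map_seminorm_topology_shift:
  "continuous_map (seminorm_topology P) (seminorm_topology P) (\<lambda>y. y - a)"
  unfolding seminorm_topology_def[of P]
proof (rule continuous_on_generated_topo, fold seminorm_topology_def)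
  fix U assume "U \<in> insert UNIV {{y. p (y - x) < r} | p x r. p \<in> P \<and> 0 < r}"
  then consider "U = UNIV" | p x r where "p \<in> P" "0 < r" "U = {y. p (y - x) < r}" by blast
  then show "openin (seminorm_topology P) ((\<lambda>y. y - a) -` U \<inter> topspace (seminorm_topology P))"
  proof cases
    case 1
    then show ?thesis
      by (metis inf_top.left_neutral openin_topspace topspace_seminorm_topology vimage_UNIV)
  next
    case (2 p x r)
    then have "(\<lambda>y. y - a) -` U \<inter> topspace (seminorm_topology P) = {y. p (y - (a + x)) < r}"
      by (auto simp: algebra_simps)
    then show ?thesis using openin_seminorm_ball 2 by metis
  qed
qed auto

lemma openin_of_continuous_seminorm:
  assumes "continuous_map (seminorm_topology P) euclideanreal p"
  shows "openin (seminorm_topology P) {y. p (y - x) < r}"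
proof -
  have "continuous_map (seminorm_topology P) euclideanreal (p \<circ> (\<lambda>y. y - x))"
    using continuous_map_seminorm_topology_shift assms by (rule continuous_map_compose)
  from openin_continuous_map_preimage[OF this, of "{..<r}"] show ?thesis
    by simp
qed

lemma openin_C_co_ball:
  "\<lbrakk>f \<in> cont_functions X; compactin X K; 0 < r\<rbrakk>
    \<Longrightarrow> openin (C_co X) {g \<in> cont_functions X. \<forall>x\<in>K. dist (g x) (f x) < r}"
  unfolding C_co_def by (rule topology_generated_by_Basis) blast

text \<open>Distinct extensional functions differ at a point of the space; its singleton is compact,
  and balls of half the distance of the two values separate them.\<close>

lemma Hausdorff_C_co: "Hausdorff_space (C_co X)"
  unfolding Hausdorff_space_def
proof (intro allI impI)
  fix f g assume "f \<in> topspace (C_co X) \<and> g \<in> topspace (C_co X) \<and> f \<noteq> g"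
  then have fg: "f \<in> cont_functions X" "g \<in> cont_functions X" "f \<noteq> g" by auto
  then obtain x where x: "x \<in> topspace X" "f x \<noteq> g x"
    unfolding cont_functions_def by (metis (no_types, lifting) extensionalityI mem_Collect_eq)
  define r where "r = dist (f x) (g x) / 2"
  have r: "0 < r" using x by (simp add: r_def)
  let ?B = "\<lambda>h. {k \<in> cont_functions X. \<forall>y\<in>{x}. dist (k y) (h y) < r}"
  have "openin (C_co X) (?B f)" "openin (C_co X) (?B g)"
    using fg x r by (auto intro!: openin_C_co_ball simp del: ball_simps)
  moreover have "disjnt (?B f) (?B g)"
  proof -
    have "False" if "dist z (f x) < r" "dist z (g x) < r" for z
      using dist_triangle2[of "f x" "g x" z] that by (simp add: r_def dist_commute)
    then show ?thesis unfolding disjnt_iff by auto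
  qed
  ultimately show "\<exists>U V. openin (C_co X) U \<and> openin (C_co X) V \<and> f \<in> U \<and> g \<in> V \<and> disjnt U V"
    using fg r by (intro exI[of _ "?B f"] exI[of _ "?B g"]) auto
qed

section \<open>Continuity and compactness of characters bounded by a C*-seminorm\<close>

context involutive_algebra
begin

text \<open>The general \<open>X\<close> and \<open>f\<close> cover both \<open>T\<close> and
  \<open>seminorm_topology {p}\<close>, and both the seminorm itself and the characters bounded by
  it.\<close>

lemma continuous_map_seminorm:
  assumes p: "cstar_seminorm scl star p"
    and op: "\<And>x r. 0 < r \<Longrightarrow> openin X {y. p (y - x) < r}" and top: "topspace X = UNIV"
    and f: "\<And>x y. dist (f y) (f x) \<le> p (y - x)"
  shows "continuous_map X (euclidean :: 'b::metric_space topology) f"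
  unfolding continuous_map_def
proof (intro conjI allI impI)
  fix U :: "'b set" assume "openin euclidean U"
  then have U: "open U" by simp
  show "openin X {x \<in> topspace X. f x \<in> U}"
  proof (subst openin_subopen, intro ballI)
    fix x assume "x \<in> {x \<in> topspace X. f x \<in> U}"
    then obtain r where "0 < r" and r: "\<And>z. dist z (f x) < r \<Longrightarrow> z \<in> U"
      using U unfolding open_dist by blast
    have "{y. p (y - x) < r} \<subseteq> {x \<in> topspace X. f x \<in> U}"
      using f top by (auto intro!: r intro: le_less_trans[of _ "p (y - x)" r for y])
    then show "\<exists>V. openin X V \<and> x \<in> V \<and> V \<subseteq> {x \<in> topspace X. f x \<in> U}"
      using op \<open>0 < r\<close> by (intro exI[of _ "{y. p (y - x) < r}"]) (simp add: cstar_zero[OF p])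
  qed
qed auto

lemma cstar_seminorm_continuousI:
  assumes p: "cstar_seminorm scl star p"
    and "\<And>x r. 0 < r \<Longrightarrow> openin X {y. p (y - x) < r}" "topspace X = UNIV"
  shows "continuous_map X euclideanreal p"
  by (rule continuous_map_seminorm[OF assms]) (simp_all add: dist_real_def cstar_abs_diff[OF p])

lemma character_continuousI:
  assumes p: "cstar_seminorm scl star p"
    and "\<And>x r. 0 < r \<Longrightarrow> openin X {y. p (y - x) < r}" "topspace X = UNIV"
    and \<phi>: "hermitian_character scl u star \<phi>" and le: "\<And>x. cmod (\<phi> x) \<le> p x"
  shows "continuous_map X euclidean \<phi>"
  by (rule continuous_map_seminorm[OF assms(1-3)])
    (simp_all add: dist_norm character_diff[OF \<phi>, symmetric] le)

lemma norm_character_le: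
  assumes p: "cstar_seminorm scl star p" and \<phi>: "hermitian_character scl u star \<phi>"
    and cont: "continuous_map (seminorm_topology {p}) euclidean \<phi>"
  shows "cmod (\<phi> x) \<le> p x"
proof (rule ccontr)
  \<comment> \<open>Otherwise \<open>x\<close> may be scaled such that \<open>\<phi> x = 1\<close> and \<open>p x < 1\<close>; its iterated squares then
    converge to \<open>0\<close> with respect to \<open>p\<close>.\<close>
  assume "\<not> ?thesis"
  then have lt: "p x < cmod (\<phi> x)" by simp
  then have nz: "\<phi> x \<noteq> 0" using cstar_nonneg[OF p, of x] by auto
  define y where "y = scl (1 / \<phi> x) x"
  have y: "\<phi> y = 1" "p y < 1"
    using lt nz by (auto simp: y_def character_scale[OF \<phi>] cstar_scale[OF p] norm_divide)
  \<comment> \<open>This topology of \<open>p\<close>-neighbourhoods contains the generators of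
    \<open>seminorm_topology {p}\<close>, so the open set \<open>W\<close> below contains a
    \<open>p\<close>-ball around 0.\<close>
  let ?O = "\<lambda>U. \<forall>a\<in>U. \<exists>r>0. {z. p (z - a) < r} \<subseteq> U"
  have ist: "istopology ?O"
    unfolding istopology_def
  proof (intro conjI allI impI)
    fix S T assume ST: "?O S" "?O T"
    show "?O (S \<inter> T)"
    proof
      fix a assume "a \<in> S \<inter> T"
      then obtain r s where "0 < r" "0 < s" "{z. p (z - a) < r} \<subseteq> S" "{z. p (z - a) < s} \<subseteq> T"
        using ST by blast
      then show "\<exists>r>0. {z. p (z - a) < r} \<subseteq> S \<inter> T"
        by (intro exI[of _ "min r s"]) auto
    qed
  qed (meson Sup_upper UnionE order_trans)
  define W where "W = {z. cmod (\<phi> z) < 1}"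
  have "openin (seminorm_topology {p}) {z \<in> topspace (seminorm_topology {p}). \<phi> z \<in> ball 0 1}"
    using cont by (rule openin_continuous_map_preimage) simp
  then have W: "openin (seminorm_topology {p}) W" by (simp add: W_def)
  have "?O W"
  proof (rule generate_topology_on_coarsest[OF ist])
    show "generate_topology_on (insert UNIV {{y. q (y - x) < r} | q x r. q \<in> {p} \<and> 0 < r}) W"
      using W unfolding seminorm_topology_def by (rule openin_topology_generated_by)
    fix S assume "S \<in> insert UNIV {{y. q (y - x) < r} | q x r. q \<in> {p} \<and> 0 < r}"
    then consider "S = UNIV" | b r where "S = {y. p (y - b) < r}" by blast
    then show "?O S"
    proof cases
      case (2 b r)
      show ?thesis
      proof
        fix a assume "a \<in> S"
        moreover have "p (z - b) \<le> p (z - a) + p (a - b)" for z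
          using cstar_triangle[OF p, of "z - a" "a - b"] by simp
        ultimately show "\<exists>r>0. {z. p (z - a) < r} \<subseteq> S"
          unfolding 2 by (intro exI[of _ "r - p (a - b)"]) (force simp: less_diff_eq intro: le_less_trans)
      qed
    qed (auto intro: exI[of _ 1])
  qed
  moreover have "0 \<in> W" by (simp add: W_def character_zero[OF \<phi>])
  ultimately obtain r where r: "0 < r" "{z. p (z - 0) < r} \<subseteq> W" by blast
  obtain n where "p y ^ n < r"
    using real_arch_pow_inv[OF r(1) y(2)] by blast
  moreover have "p y ^ (2 ^ n) \<le> p y ^ n"
    using y(2) by (intro power_decreasing) (auto simp: cstar_nonneg[OF p] less_imp_le)
  ultimately have "iter_square n y \<in> W"
    using r(2) by (auto simp: cstar_iter_square[OF p])
  then show False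
    by (simp add: W_def character_iter_square[OF \<phi>] y)
qed

text \<open>For a C*-seminorm \<open>p\<close> these are the hermitian characters continuous with
  respect to \<open>p\<close> alone, by \<open>norm_character_le\<close> and
  \<open>character_continuousI\<close>.\<close>

definition bounded_characters :: "('a \<Rightarrow> real) \<Rightarrow> ('a \<Rightarrow> complex) set" where
  "bounded_characters p = {\<phi>. hermitian_character scl u star \<phi> \<and> (\<forall>x. cmod (\<phi> x) \<le> p x)}"

text \<open>Tychonoff: pointwise equations cut out a closed subset of a product of discs of radius
  \<open>p x\<close>.\<close>

lemma compact_bounded_characters: "compact (bounded_characters p)"
proof -
  have coord: "continuous_on UNIV (\<lambda>\<phi>::'a \<Rightarrow> complex. \<phi> x)" for x
    by (rule continuous_on_product_coordinates)
  have lin: "Vector_Spaces.linear scl (*) \<phi> \<longleftrightarrow>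
      (\<forall>x y. \<phi> (x + y) = \<phi> x + \<phi> y) \<and> (\<forall>c x. \<phi> (scl c x) = c * \<phi> x)" for \<phi>
    unfolding Vector_Spaces.linear_iff
    using vector_space_axioms vector_space_over_itself.vector_space_axioms by blast
  have "closed {\<phi>. hermitian_character scl u star \<phi>}"
    unfolding hermitian_character_def lin
    by (intro closed_Collect_conj closed_Collect_all closed_Collect_eq coord continuous_intros)
  moreover have "bounded_characters p =
      {\<phi>. hermitian_character scl u star \<phi>} \<inter> (PiE UNIV (\<lambda>x. cball 0 (p x)))"
    by (auto simp: bounded_characters_def PiE_def Pi_def)
  moreover have "compact (PiE UNIV (\<lambda>x. cball (0::complex) (p x)))"
    unfolding compactin_euclidean_iff[symmetric] euclidean_product_topology[symmetric] compactin_PiE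
    by simp
  ultimately show ?thesis by (simp add: closed_Int_compact)
qed

lemma compactin_char_space:
  "compactin (char_space scl u star T) K \<longleftrightarrow> compact K \<and> K \<subseteq> cont_hermitian_characters scl u star T"
  by (simp add: char_space_def compactin_subtopology euclidean_product_topology)

text \<open>The strict bound passes to \<open>p x\<close> because some bounded character attains it.
  If \<open>p x = 0\<close>, there may be no bounded character, and \<open>0 < r\<close> settles the
  case.\<close>

lemma seminorm_ball_eq_characters:
  assumes p: "cstar_seminorm scl star p" and "0 < r"
  shows "p x < r \<longleftrightarrow> (\<forall>\<phi>\<in>bounded_characters p. cmod (\<phi> x) < r)"
proof
  assume R: "\<forall>\<phi>\<in>bounded_characters p. cmod (\<phi> x) < r"
  show "p x < r"
  proof (cases "p x = 0")
    case False
    obtain \<phi> where "hermitian_character scl u star \<phi>" "\<And>a. cmod (\<phi> a) \<le> p a" "cmod (\<phi> x) = p x"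
      using cstar_seminorm_attained[OF p False] by blast
    then show ?thesis
      using R by (auto simp: bounded_characters_def)
  qed (use assms in simp)
next
  assume "p x < r"
  then show "\<forall>\<phi>\<in>bounded_characters p. cmod (\<phi> x) < r"
    by (auto simp: bounded_characters_def intro: le_less_trans[of _ "p x" r])
qed

text \<open>By \<open>sub\<close> the compact set \<open>bounded_characters p\<close> lies in the
  character space, so it defines a generating open set of \<open>C_co\<close>.\<close>

lemma gelfand_vimage_ball:
  assumes p: "cstar_seminorm scl star p" and "0 < r"
    and sub: "bounded_characters p \<subseteq> cont_hermitian_characters scl u star T"
  obtains V where "openin (C_co (char_space scl u star T)) V"
    "gelfand scl u star T -` V = {y. p (y - x) < r}"
proof
  let ?X = "char_space scl u star T" and ?K = "bounded_characters p" and ?G = "gelfand scl u star T"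
  let ?V = "{g \<in> cont_functions ?X. \<forall>\<phi>\<in>?K. dist (g \<phi>) (?G x \<phi>) < r}"
  have G: "?G y \<in> cont_functions ?X" for y
    using gelfand_in_C_co by simp
  show "openin (C_co ?X) ?V"
    using compact_bounded_characters sub G \<open>0 < r\<close>
    by (intro openin_C_co_ball) (simp_all add: compactin_char_space)
  have "dist (?G y \<phi>) (?G x \<phi>) = cmod (\<phi> (y - x))" if "\<phi> \<in> ?K" for y \<phi>
    using that sub by (auto simp: gelfand_def dist_norm bounded_characters_def character_diff)
  then show "?G -` ?V = {y. p (y - x) < r}"
    using G by (auto simp: seminorm_ball_eq_characters[OF p \<open>0 < r\<close>])
qed

section \<open>Suprema over compact sets of characters\<close>

definition sup_seminorm :: "('a \<Rightarrow> complex) set \<Rightarrow> 'a \<Rightarrow> real" where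
  "sup_seminorm K x = (SUP \<phi>\<in>K. cmod (\<phi> x))"

context
  fixes K assumes K: "compact K" "K \<noteq> {}" "\<And>\<phi>. \<phi> \<in> K \<Longrightarrow> hermitian_character scl u star \<phi>"
begin

lemma continuous_on_evaluation: "continuous_on K (\<lambda>\<phi>::'a \<Rightarrow> complex. \<phi> x)"
  by (rule continuous_on_subset[OF continuous_on_product_coordinates]) simp

lemma norm_le_sup_seminorm: "\<phi> \<in> K \<Longrightarrow> cmod (\<phi> x) \<le> sup_seminorm K x"
  unfolding sup_seminorm_def
  by (intro cSUP_upper compact_imp_bounded[THEN bounded_imp_bdd_above] compact_continuous_image K
      continuous_intros continuous_on_evaluation)

lemma sup_seminorm_attained: "\<exists>\<phi>\<in>K. sup_seminorm K x = cmod (\<phi> x)"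
proof -
  obtain \<phi> where \<phi>: "\<phi> \<in> K" "\<And>\<psi>. \<psi> \<in> K \<Longrightarrow> cmod (\<psi> x) \<le> cmod (\<phi> x)"
    using continuous_attains_sup[OF K(1,2) continuous_on_norm[OF continuous_on_evaluation]] by blast
  then have "sup_seminorm K x \<le> cmod (\<phi> x)"
    unfolding sup_seminorm_def by (intro cSUP_least K)
  then show ?thesis
    using norm_le_sup_seminorm[OF \<phi>(1)] \<phi>(1) by (metis order_antisym)
qed

lemma cstar_sup_seminorm: "cstar_seminorm scl star (sup_seminorm K)"
proof (rule cstar_seminormI)
  show "0 \<le> sup_seminorm K x" for x
    using sup_seminorm_attained[of x] by auto
  show "sup_seminorm K (x + y) \<le> sup_seminorm K x + sup_seminorm K y" for x y
  proof -
    obtain \<phi> where \<phi>: "\<phi> \<in> K" "sup_seminorm K (x + y) = cmod (\<phi> (x + y))"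
      using sup_seminorm_attained by blast
    then show ?thesis
      using norm_triangle_ineq[of "\<phi> x" "\<phi> y"] norm_le_sup_seminorm[OF \<phi>(1), of x]
        norm_le_sup_seminorm[OF \<phi>(1), of y]
      by (simp add: character_add[OF K(3)])
  qed
  show "sup_seminorm K (scl c x) \<le> cmod c * sup_seminorm K x" for c x
  proof -
    obtain \<phi> where "\<phi> \<in> K" "sup_seminorm K (scl c x) = cmod (\<phi> (scl c x))"
      using sup_seminorm_attained by blast
    then show ?thesis
      by (simp add: character_scale[OF K(3)] norm_mult mult_left_mono norm_le_sup_seminorm)
  qed
  show "sup_seminorm K 0 = 0"
    using sup_seminorm_attained[of 0] by (auto simp: character_zero[OF K(3)])
  show "sup_seminorm K (x * star x) = (sup_seminorm K x)\<^sup>2" for x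
  proof (rule antisym)
    have sq: "cmod (\<phi> (x * star x)) = (cmod (\<phi> x))\<^sup>2" if "\<phi> \<in> K" for \<phi>
      by (simp add: character_mult[OF K(3)] character_star[OF K(3)] that norm_mult power2_eq_square)
    obtain \<phi> where "\<phi> \<in> K" "sup_seminorm K (x * star x) = cmod (\<phi> (x * star x))"
      using sup_seminorm_attained by blast
    then show "sup_seminorm K (x * star x) \<le> (sup_seminorm K x)\<^sup>2"
      by (simp add: sq power_mono norm_le_sup_seminorm)
    obtain \<phi> where "\<phi> \<in> K" "sup_seminorm K x = cmod (\<phi> x)"
      using sup_seminorm_attained by blast
    then show "(sup_seminorm K x)\<^sup>2 \<le> sup_seminorm K (x * star x)"
      by (metis norm_le_sup_seminorm sq)
  qed
qed

text \<open>If \<open>\<phi> \<notin> K\<close>, compactness provides an element \<open>b\<close> in the kernel of \<open>\<phi>\<close>, a finite sum of elements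
  \<open>a * star a\<close>, whose transform is strictly positive on \<open>K\<close>. For a large scalar \<open>M\<close> the element
  \<open>M u - b\<close> is then smaller than \<open>M\<close> on \<open>K\<close>, but takes the value \<open>M\<close> at \<open>\<phi>\<close>.\<close>

lemma bounded_characters_sup_seminorm:
  assumes \<phi>: "hermitian_character scl u star \<phi>" and le: "\<And>x. cmod (\<phi> x) \<le> sup_seminorm K x"
  shows "\<phi> \<in> K"
proof (rule ccontr)
  assume "\<phi> \<notin> K"
  have "\<exists>a. \<phi> a = 0 \<and> \<psi> a \<noteq> 0" if "\<psi> \<in> K" for \<psi>
  proof -
    \<comment> \<open>Subtracting the scalar \<open>\<phi> a\<close> moves a separating element into
      the kernel of \<open>\<phi>\<close>.\<close>
    obtain a where "\<psi> a \<noteq> \<phi> a" using \<open>\<psi> \<in> K\<close> \<open>\<phi> \<notin> K\<close> by (metis ext)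
    then show ?thesis
      using \<phi> K(3)[OF that]
      by (intro exI[of _ "a - scl (\<phi> a) u"]) (simp add: hermitian_characterD)
  qed
  then have cover: "K \<subseteq> (\<Union>a\<in>{a. \<phi> a = 0}. {\<psi>. \<psi> a \<noteq> 0})" by blast
  have op: "open {\<psi>::'a \<Rightarrow> complex. \<psi> a \<noteq> 0}" for a
    by (intro open_Collect_neq continuous_on_product_coordinates continuous_on_const)
  obtain F where F: "F \<subseteq> {a. \<phi> a = 0}" "finite F" "K \<subseteq> (\<Union>a\<in>F. {\<psi>. \<psi> a \<noteq> 0})"
    by (rule compactE_image[OF K(1) op cover])
  define b where "b = (\<Sum>a\<in>F. a * star a)"
  define s where "s \<psi> = (\<Sum>a\<in>F. (cmod (\<psi> a))\<^sup>2)" for \<psi> :: "'a \<Rightarrow> complex"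
  have b: "\<psi> b = of_real (s \<psi>)" if "hermitian_character scl u star \<psi>" for \<psi>
    unfolding b_def character_sum[OF that] s_def of_real_sum
    by (intro sum.cong refl)
      (simp add: character_mult[OF that] character_star[OF that] complex_norm_square
        del: of_real_power)
  have "s \<phi> = 0" using F(1) by (auto simp: s_def intro!: sum.neutral)
  have s_pos: "0 < s \<psi>" if "\<psi> \<in> K" for \<psi>
  proof -
    obtain a where "a \<in> F" "\<psi> a \<noteq> 0" using F(3) \<open>\<psi> \<in> K\<close> by blast
    then show ?thesis
      unfolding s_def by (intro sum_pos2[OF F(2)]) auto
  qed
  have "continuous_on K s"
    unfolding s_def by (intro continuous_intros continuous_on_evaluation)
  then obtain \<psi>\<^sub>M where M: "\<psi>\<^sub>M \<in> K" "\<And>\<psi>. \<psi> \<in> K \<Longrightarrow> s \<psi> \<le> s \<psi>\<^sub>M"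
    using continuous_attains_sup[OF K(1,2)] by blast
  \<comment> \<open>With the maximum of \<open>s\<close> over \<open>K\<close> as scalar, the
    transform of \<open>?c\<close> is nonnegative on \<open>K\<close> and strictly below that
    maximum, which is its value at \<open>\<phi>\<close>.\<close>
  let ?c = "scl (of_real (s \<psi>\<^sub>M)) u - b"
  have c: "\<psi> ?c = of_real (s \<psi>\<^sub>M - s \<psi>)" if "hermitian_character scl u star \<psi>" for \<psi>
    using that by (simp add: hermitian_characterD b)
  obtain \<psi> where \<psi>: "\<psi> \<in> K" "sup_seminorm K ?c = cmod (\<psi> ?c)"
    using sup_seminorm_attained by blast
  have "s \<psi>\<^sub>M \<le> s \<psi>\<^sub>M - s \<psi>"
    using le[of ?c] \<psi> M(2)[OF \<psi>(1)] s_pos[OF M(1)] \<open>s \<phi> = 0\<close>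
    by (simp add: c \<phi> K(3) norm_of_real del: of_real_diff)
  then show False using s_pos[OF \<psi>(1)] by simp
qed

end

end

section \<open>The topology of an LC*-algebra against the compact-open topology\<close>

context LC_star_algebra
begin

lemma seminorms:
  obtains P where "\<And>p. p \<in> P \<Longrightarrow> cstar_seminorm scl star p" "T = seminorm_topology P"
  using topology_by_cstar_seminorms by blast

lemma topspace_T: "topspace T = UNIV"
  using seminorms by (metis topspace_seminorm_topology)

lemma spectral_iff:
  assumes p: "cstar_seminorm scl star p"
  shows "spectral scl u star T p \<longleftrightarrow> bounded_characters p \<subseteq> cont_hermitian_characters scl u star T"
proof -
  have "continuous_map (seminorm_topology {p}) euclidean \<phi> \<longleftrightarrow> (\<forall>x. cmod (\<phi> x) \<le> p x)"
    if "hermitian_character scl u star \<phi>" for \<phi>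
    using norm_character_le[OF p that] character_continuousI[OF p _ _ that, of "seminorm_topology {p}"]
    by (auto intro: openin_seminorm_ball)
  then show ?thesis
    by (auto simp: spectral_def bounded_characters_def cont_hermitian_characters_def)
qed

text \<open>Characters bounded by a defining seminorm are continuous, so by
  \<open>gelfand_vimage_ball\<close> the generating balls of \<open>T\<close> are open in the
  topology pulled back from \<open>C_co\<close>.\<close>

lemma openin_imp_gelfand_vimage:
  assumes "openin T U"
  obtains V where "openin (C_co (char_space scl u star T)) V" "U = gelfand scl u star T -` V"
proof -
  let ?C = "C_co (char_space scl u star T)"
  obtain P where P: "\<And>p. p \<in> P \<Longrightarrow> cstar_seminorm scl star p" "T = seminorm_topology P"
    using seminorms by blast
  have "openin (pullback_topology UNIV (gelfand scl u star T) ?C) U"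
  proof (rule seminorm_topology_coarsest)
    show "openin (seminorm_topology P) U" using assms P by simp
    show "topspace (pullback_topology UNIV (gelfand scl u star T) ?C) = UNIV"
      using gelfand_in_C_co by (auto simp: topspace_pullback_topology simp del: topspace_C_co)
    fix p x and r :: real assume "p \<in> P" "0 < r"
    moreover have "bounded_characters p \<subseteq> cont_hermitian_characters scl u star T"
      using character_continuousI[OF P(1)[OF \<open>p \<in> P\<close>], of T] openin_seminorm_ball[OF \<open>p \<in> P\<close>] P(2)
      by (auto simp: bounded_characters_def cont_hermitian_characters_def)
    ultimately obtain V where "openin ?C V" "gelfand scl u star T -` V = {y. p (y - x) < r}"
      using gelfand_vimage_ball[OF P(1)] by metis
    then show "openin (pullback_topology UNIV (gelfand scl u star T) ?C) {y. p (y - x) < r}"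
      unfolding openin_pullback_topology by auto
  qed
  then show ?thesis using that by (auto simp: openin_pullback_topology)
qed

text \<open>For nonempty compact \<open>K\<close> the supremum over \<open>K\<close> is spectral,
  since by \<open>bounded_characters_sup_seminorm\<close> its bounded characters lie in
  \<open>K\<close>. Hence it is continuous, and its balls control uniform distance on
  \<open>K\<close>.\<close>

lemma continuous_map_gelfand:
  assumes cont: "\<And>p. cstar_seminorm scl star p \<Longrightarrow> spectral scl u star T p \<Longrightarrow>
    continuous_map T euclideanreal p"
  shows "continuous_map T (C_co (char_space scl u star T)) (gelfand scl u star T)"
  unfolding C_co_def
proof (rule continuous_on_generated_topo)
  let ?X = "char_space scl u star T" and ?G = "gelfand scl u star T"
  fix U assume "U \<in> {{g \<in> cont_functions ?X. \<forall>x\<in>K. dist (g x) (f x) < r} | f K r.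
    f \<in> cont_functions ?X \<and> compactin ?X K \<and> 0 < r}"
  then obtain f K r where U: "U = {g \<in> cont_functions ?X. \<forall>x\<in>K. dist (g x) (f x) < r}"
    and f: "f \<in> cont_functions ?X" and K: "compactin ?X K" "0 < r" by blast
  have Kc: "compact K" "K \<subseteq> cont_hermitian_characters scl u star T"
    using K by (simp_all add: compactin_char_space)
  then have herm: "hermitian_character scl u star \<phi>" if "\<phi> \<in> K" for \<phi>
    using that by (auto simp: cont_hermitian_characters_def)
  have pre: "?G -` U \<inter> topspace T = {a. \<forall>\<phi>\<in>K. dist (\<phi> a) (f \<phi>) < r}"
    using gelfand_in_C_co Kc by (auto simp: U gelfand_def topspace_T)
  show "openin T (?G -` U \<inter> topspace T)"
  proof (cases "K = {}")
    case True
    then show ?thesis using pre openin_topspace[of T] topspace_T by simp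
  next
    case False
    let ?p = "sup_seminorm K"
    have p: "cstar_seminorm scl star ?p"
      using cstar_sup_seminorm[OF Kc(1) False herm] .
    have "spectral scl u star T ?p"
      using bounded_characters_sup_seminorm[OF Kc(1) False herm] Kc(2)
      unfolding spectral_iff[OF p] by (auto simp: bounded_characters_def)
    then have "continuous_map T euclideanreal ?p" using cont p by blast
    then have ball: "openin T {y. ?p (y - x) < d}" for x d
      using openin_of_continuous_seminorm seminorms by metis
    show ?thesis
      unfolding pre
    proof (subst openin_subopen, intro ballI)
      fix a assume a: "a \<in> {a. \<forall>\<phi>\<in>K. dist (\<phi> a) (f \<phi>) < r}"
      have "continuous_map ?X euclidean f" using f by (simp add: cont_functions_def)
      then have "continuous_map (subtopology ?X K) euclidean f"
        by (rule continuous_map_from_subtopology)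
      moreover have "subtopology ?X K = top_of_set K"
        using Kc(2) by (simp add: char_space_def euclidean_product_topology subtopology_subtopology inf.absorb2)
      ultimately have "continuous_on K f" by simp
      then have "continuous_on K (\<lambda>\<phi>. dist (\<phi> a) (f \<phi>))" (is "continuous_on K ?h")
        by (intro continuous_intros continuous_on_subset[OF continuous_on_product_coordinates]) auto
      then obtain \<psi> where \<psi>: "\<psi> \<in> K" "\<And>\<phi>. \<phi> \<in> K \<Longrightarrow> dist (\<phi> a) (f \<phi>) \<le> dist (\<psi> a) (f \<psi>)"
        using continuous_attains_sup[OF Kc(1) False, of ?h] by blast
      \<comment> \<open>The distance to \<open>f\<close> attains its maximum on \<open>K\<close>, so
        the margin \<open>d\<close> is uniform over the characters in \<open>K\<close>.\<close>
      define d where "d = r - dist (\<psi> a) (f \<psi>)"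
      have "0 < d" using a \<psi>(1) by (simp add: d_def)
      have "{y. ?p (y - a) < d} \<subseteq> {a. \<forall>\<phi>\<in>K. dist (\<phi> a) (f \<phi>) < r}"
      proof clarify
        fix y \<phi> assume y: "?p (y - a) < d" and \<phi>: "\<phi> \<in> K"
        have "dist (\<phi> y) (\<phi> a) \<le> ?p (y - a)"
          using norm_le_sup_seminorm[OF Kc(1) False herm \<phi>, of "y - a"]
          by (simp add: dist_norm character_diff[OF herm[OF \<phi>]])
        then show "dist (\<phi> y) (f \<phi>) < r"
          using dist_triangle[of "\<phi> y" "f \<phi>" "\<phi> a"] \<psi>(2)[OF \<phi>] y by (simp add: d_def)
      qed
      then show "\<exists>V. openin T V \<and> a \<in> V \<and> V \<subseteq> {a. \<forall>\<phi>\<in>K. dist (\<phi> a) (f \<phi>) < r}"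
        using ball[of a d] \<open>0 < d\<close> by (intro exI[of _ "{y. ?p (y - a) < d}"]) (simp add: cstar_zero[OF p])
    qed
  qed
qed (fold topology_generated_by_topspace, fold C_co_def, use gelfand_in_C_co in blast)

text \<open>Open sets of \<open>T\<close> are preimages under the transform. Points with equal
  transforms thus lie in the same open sets, and images of open sets are relatively open.\<close>

lemma embedding_gelfandI:
  assumes "Hausdorff_space T"
    and cont: "continuous_map T (C_co (char_space scl u star T)) (gelfand scl u star T)"
  shows "embedding_map T (C_co (char_space scl u star T)) (gelfand scl u star T)"
proof -
  let ?C = "C_co (char_space scl u star T)" and ?G = "gelfand scl u star T"
  have "inj ?G"
  proof (rule injI, rule ccontr)
    fix a b assume ab: "?G a = ?G b" "a \<noteq> b"
    then obtain U where "openin T U" "a \<in> U" "b \<notin> U"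
      using assms(1) topspace_T unfolding Hausdorff_space_def disjnt_iff by (metis UNIV_I)
    then show False
      using openin_imp_gelfand_vimage[of U] ab by (metis vimage_eq)
  qed
  moreover have "open_map T (subtopology ?C (range ?G)) ?G"
    unfolding open_map_def
  proof (intro allI impI)
    fix U assume "openin T U"
    then obtain V where "openin ?C V" "U = ?G -` V" using openin_imp_gelfand_vimage by blast
    then show "openin (subtopology ?C (range ?G)) (?G ` U)"
      by (auto simp: openin_subtopology)
  qed
  moreover have "topspace (subtopology ?C (range ?G)) = range ?G"
    using gelfand_in_C_co by (auto simp del: topspace_C_co)
  ultimately show ?thesis
    unfolding embedding_map_def topspace_T
    by (intro bijective_open_imp_homeomorphic_map)
      (simp_all add: topspace_T continuous_map_in_subtopology cont)
qed

end

theorem proposition2p8: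
  fixes scl :: "complex \<Rightarrow> 'a::comm_ring \<Rightarrow> 'a"
    and u :: 'a and star :: "'a \<Rightarrow> 'a" and T :: "'a topology"
  assumes "LC_star_algebra scl u star T"
  shows "embedding_map T (C_co (char_space scl u star T)) (gelfand scl u star T) \<longleftrightarrow>
    Hausdorff_space T \<and>
    (\<forall>p. cstar_seminorm scl star p \<and> spectral scl u star T p \<longrightarrow>
       continuous_map T euclideanreal p)"
proof -
  interpret LC_star_algebra scl u star T by (rule assms)
  let ?C = "C_co (char_space scl u star T)" and ?G = "gelfand scl u star T"
  show ?thesis
  proof
    assume emb: "embedding_map T ?C ?G"
    have "Hausdorff_space T"
      using embedding_map_imp_homeomorphic_space[OF emb] homeomorphic_Hausdorff_space
        Hausdorff_space_subtopology[OF Hausdorff_C_co] by blast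
    moreover have "continuous_map T euclideanreal p"
      if p: "cstar_seminorm scl star p" "spectral scl u star T p" for p
    proof (rule cstar_seminorm_continuousI[OF p(1) _ topspace_T])
      fix x and r :: real assume "0 < r"
      \<comment> \<open>A ball of a spectral seminorm is the preimage of an open set of
        \<open>C_co\<close>, hence open by continuity of the transform.\<close>
      then obtain V where V: "openin ?C V" "?G -` V = {y. p (y - x) < r}"
        using gelfand_vimage_ball[OF p(1)] p(2) spectral_iff[OF p(1)] by metis
      have "continuous_map T ?C ?G"
        using emb by (simp add: embedding_map_def homeomorphic_imp_continuous_map
            continuous_map_in_subtopology homeomorphic_eq_everything_map)
      from openin_continuous_map_preimage[OF this V(1)]
      show "openin T {y. p (y - x) < r}"
        by (simp add: V(2)[symmetric] topspace_T vimage_def)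
    qed
    ultimately show "Hausdorff_space T \<and> (\<forall>p. cstar_seminorm scl star p \<and>
        spectral scl u star T p \<longrightarrow> continuous_map T euclideanreal p)" by blast
  qed (use embedding_gelfandI continuous_map_gelfand in blast)
qed

end
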